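(* Let $n\ge 1$, $L\ge 1$, and let $\boldsymbol{\bar\mu}^{n,L}=[\bar\mu(u)]_{u\in\Sigma^L}$ be the column vector of values of the valuation $\bar\mu$ on words of length $L$. Then $\boldsymbol{\bar\mu}^{n,L}$ is the stationary vector for the de Bruijn process on $G^{n,L}$, i.e. $$M^{n,L}\,\boldsymbol{\bar\mu}^{n,L}=\Delta^{n,L}\,\boldsymbol{\bar\mu}^{n,L}.$$
   Context: Let $\Sigma=\{1,\dots,n\}$, let $\Sigma^L$ be the set of words of length $L$ over $\Sigma$, and $\Sigma^+$ the set of all nonempty words. Concatenation is written with a dot or by juxtaposition. Let $x_{a,k}$ ($a\in\Sigma$, $k\ge1$) be independent commuting formal variables; all quantities below are rational functions in these variables. For $u=u_1\cdots u_L\in\Sigma^L$ with $L\ge 1$, put $h(u)=u_1\cdots u_{L-1}$ (head) and $t(u)=u_2\cdots u_L$ (tail); both are the empty word if $L=1$. For $u\in\Sigma^+$, if the last block of $u$ (the maximal suffix of $u$ consisting of repetitions of a single letter) is $a^k$, put $\beta(u)=x_{a,k}$. For $a\in\Sigma$ put $\partial_a u=t(u).a$. The de Bruijn graph $G^{n,L}$ has vertex set $\Sigma^L$ and an edge from $u$ to $v$ if and only if $h(v)=t(u)$. The de Bruijn process is the continuous-time Markov chain on $\Sigma^L$ in which the transition $u\to v$ along an edge has rate $\beta(v)$. The matrix $M^{n,L}$, indexed by $\Sigma^L\times\Sigma^L$, has entries $M^{n,L}_{v,u}=\beta(v)$ if $h(v)=t(u)$ and $0$ otherwise. The diagonal matrix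 $\Delta^{n,L}$ consists of the column sums of $M^{n,L}$: $\Delta^{n,L}_{u,u}=\sum_{a\in\Sigma}\beta(\partial_a u)$. For $u\in\Sigma^+$ put $$\mu(u)=\frac{\beta(u)}{\sum_{a\in\Sigma}\beta(\partial_a u)},\qquad \bar\mu(u)=\prod_{i=1}^{L}\mu(u_1u_2\cdots u_i)\quad\text{for } u=u_1u_2\cdots u_L .$$ *)

theory Defs
  imports
    "HOL-Library.Poly_Mapping"
    "HOL-Library.Product_Lexorder"
    "HOL-Computational_Algebra.Polynomial_Factorial"
begin

text \<open>
  Polynomials in the indeterminates \<open>x_{a,k}\<close> over a coefficient field are finitely supported maps
  from monomials to coefficients, a monomial being a finitely supported map from index pairs
  \<open>(a, k)\<close> to exponents.  The lexicographic order on pairs is imported only because the library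
  derives the integral domain instance of such polynomials from a linear order on monomials.
\<close>

type_synonym 'k ratfun = "(((nat \<times> nat) \<Rightarrow>\<^sub>0 nat) \<Rightarrow>\<^sub>0 'k) fract"

definition var :: "nat \<Rightarrow> nat \<Rightarrow> 'k::field ratfun" where
  "var a k = to_fract (Poly_Mapping.single (Poly_Mapping.single (a, k) 1) 1)"

type_synonym word = "nat list"

definition words :: "nat \<Rightarrow> nat \<Rightarrow> word set" where
  "words n L = {u. set u \<subseteq> {1..n} \<and> length u = L}"

text \<open>For a nonempty word, the second argument of \<^const>\<open>var\<close> below is the length of the last block.\<close>

definition beta :: "word \<Rightarrow> 'k::field ratfun" where
  "beta u = var (last u) (length (takeWhile (\<lambda>b. b = last u) (rev u)))"

definition del :: "nat \<Rightarrow> word \<Rightarrow> word" where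
  "del a u = tl u @ [a]"

definition mu :: "nat \<Rightarrow> word \<Rightarrow> 'k::field ratfun" where
  "mu n u = beta u / (\<Sum>a\<in>{1..n}. beta (del a u))"

definition mubar :: "nat \<Rightarrow> word \<Rightarrow> 'k::field ratfun" where
  "mubar n u = (\<Prod>i=1..length u. mu n (take i u))"

text \<open>Heads and tails of words are \<^const>\<open>butlast\<close> and \<^const>\<open>tl\<close>.\<close>

definition debruijn_edges :: "nat \<Rightarrow> nat \<Rightarrow> (word \<times> word) set" where
  "debruijn_edges n L = {(u, v). u \<in> words n L \<and> v \<in> words n L \<and> butlast v = tl u}"

text \<open>
  A matrix indexed by the words of length \<open>L\<close> is a function of row and column index.
  In \<open>debruijn_matrix n L v u\<close> the row index \<open>v\<close> is the target of the transition and the column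
  index \<open>u\<close> its source, so the entry is the rate of \<open>u \<rightarrow> v\<close>.
\<close>

definition debruijn_matrix :: "nat \<Rightarrow> nat \<Rightarrow> word \<Rightarrow> word \<Rightarrow> 'k::field ratfun" where
  "debruijn_matrix n L v u = (if (u, v) \<in> debruijn_edges n L then beta v else 0)"

definition column_sum_matrix :: "nat \<Rightarrow> nat \<Rightarrow> word \<Rightarrow> word \<Rightarrow> 'k::field ratfun" where
  "column_sum_matrix n L v u = (if v = u then \<Sum>w\<in>words n L. debruijn_matrix n L w u else 0)"

definition mat_vec ::
    "nat \<Rightarrow> nat \<Rightarrow> (word \<Rightarrow> word \<Rightarrow> 'k::field ratfun) \<Rightarrow> (word \<Rightarrow> 'k ratfun) \<Rightarrow> word \<Rightarrow> 'k ratfun" where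
  "mat_vec n L A x v = (\<Sum>u\<in>words n L. A v u * x u)"

definition stationary_vector :: "nat \<Rightarrow> nat \<Rightarrow> (word \<Rightarrow> 'k::field ratfun) \<Rightarrow> bool" where
  "stationary_vector n L x \<longleftrightarrow>
     (\<forall>v\<in>words n L. mat_vec n L (debruijn_matrix n L) x v = mat_vec n L (column_sum_matrix n L) x v)"

lemma column_sum_matrix_diag:
  assumes "L \<ge> 1" "u \<in> words n L"
  shows "column_sum_matrix n L u u = (\<Sum>a\<in>{1..n}. beta (del a u))"
proof -
  have fin: "finite (words n L)"
    unfolding words_def using finite_lists_length_eq[of "{1..n}" L] by simp
  have img: "{w \<in> words n L. (u, w) \<in> debruijn_edges n L} = (\<lambda>a. del a u) ` {1..n}" (is "?A = ?B")
  proof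
    show "?A \<subseteq> ?B"
    proof
      fix w assume w: "w \<in> ?A"
      hence ne: "w \<noteq> []" and "butlast w = tl u" and "set w \<subseteq> {1..n}"
        using assms by (auto simp: words_def debruijn_edges_def)
      hence "w = del (last w) u" "last w \<in> {1..n}"
        using append_butlast_last_id[OF ne] last_in_set[OF ne] unfolding del_def by (metis, blast)
      thus "w \<in> ?B" by blast
    qed
    show "?B \<subseteq> ?A"
      using assms by (cases u) (auto simp: words_def debruijn_edges_def del_def)
  qed
  have "column_sum_matrix n L u u = (\<Sum>w\<in>?A. beta w)"
    unfolding column_sum_matrix_def debruijn_matrix_def
    using fin by (simp add: sum.If_cases Int_def)
  also have "\<dots> = (\<Sum>a\<in>{1..n}. beta (del a u))"
    unfolding img by (subst sum.reindex) (auto simp: inj_on_def del_def)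
  finally show ?thesis .
qed

text \<open>The denominators in \<^const>\<open>mu\<close> are nonzero, so its quotients are genuine ones.\<close>

lemma sum_beta_del_nonzero:
  assumes "n \<ge> 1"
  shows "(\<Sum>a\<in>{1..n}. beta (del a u)) \<noteq> (0 :: 'k::field ratfun)"
proof -
  define r where "r a = length (takeWhile (\<lambda>b. b = a) (rev (del a u)))" for a
  define p :: "((nat \<times> nat) \<Rightarrow>\<^sub>0 nat) \<Rightarrow>\<^sub>0 'k" where
    "p = (\<Sum>a\<in>{1..n}. Poly_Mapping.single (Poly_Mapping.single (a, r a) 1) 1)"
  have "Poly_Mapping.lookup p (Poly_Mapping.single (1, r 1) 1) =
        (\<Sum>a\<in>{1..n}. if a = 1 then 1 else 0)"
    unfolding p_def lookup_sum
  proof (rule sum.cong[OF refl])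
    fix a
    have "Poly_Mapping.single (a, r a) (1::nat) = Poly_Mapping.single (1, r 1) 1 \<longleftrightarrow> a = 1"
      by (metis keys_single one_neq_zero prod.inject singleton_inject)
    thus "Poly_Mapping.lookup (Poly_Mapping.single (Poly_Mapping.single (a, r a) (1::nat)) (1::'k))
            (Poly_Mapping.single (1, r 1) 1) = (if a = 1 then 1 else 0)"
      unfolding lookup_single when_def by presburger
  qed
  also have "\<dots> = 1"
    using assms by (simp add: sum.delta)
  finally have "p \<noteq> 0" by auto
  moreover have "(\<Sum>a\<in>{1..n}. beta (del a u)) = to_fract p"
    unfolding p_def to_fract_sum beta_def var_def r_def by (simp add: del_def)
  ultimately show ?thesis by simp
qed

end

theory Submission
  imports Defs
begin

text \<open>
  The denominator of \<^term>\<open>mu n u\<close> depends only on \<^term>\<open>tl u\<close>, so stationarity at \<open>v = w.b\<close>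
  reduces to the marginal identity \<open>(\<Sum>a. mubar (a.w)) = mubar w\<close>.  This is proved by induction on
  \<open>w\<close> from the right.  Prepending a letter \<open>a\<close> changes the last block only if the word is a power of
  \<open>a\<close>, and for \<open>w = b^k\<close> the resulting changes of numerator and denominator cancel.
\<close>

text \<open>The denominator of \<open>mu n u\<close> is \<open>out_rate n (tl u)\<close>; taking the
  tail as argument lets denominators of \<open>w\<close> and \<open>b # w\<close> be
  compared.\<close>

definition out_rate :: "nat \<Rightarrow> word \<Rightarrow> 'k::field ratfun" where
  "out_rate n w = (\<Sum>a\<in>{1..n}. beta (w @ [a]))"

lemma out_rate_nonzero:
  assumes "n \<ge> 1"
  shows "out_rate n w \<noteq> (0 :: 'k::field ratfun)"
  \<comment> \<open>\<open>undefined\<close> is a dummy first letter, which \<open>del\<close>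
    discards.\<close>
  using sum_beta_del_nonzero[OF assms, of "undefined # w", where 'k = 'k]
  by (simp add: out_rate_def del_def)

lemma mubar_Nil [simp]: "mubar n [] = 1"
  by (simp add: mubar_def)

lemma mubar_snoc: 
  "mubar n (w @ [b]) = (mubar n w * beta (w @ [b]) / out_rate n (tl (w @ [b])) :: 'k::field ratfun)"
proof -
  have "mubar n (w @ [b]) = (\<Prod>i=1..length w. mu n (take i (w @ [b]))) * (mu n (w @ [b]) :: 'k ratfun)"
    unfolding mubar_def by simp
  also have "(\<Prod>i=1..length w. mu n (take i (w @ [b]))) = mubar n w"
    unfolding mubar_def by (rule prod.cong) auto
  finally show ?thesis
    by (simp add: mu_def out_rate_def del_def)
qed

lemma beta_Cons:
  assumes "w \<noteq> []" "set w \<noteq> {a}"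
  shows "beta (a # w) = (beta w :: 'k::field ratfun)"
proof -
  let ?P = "\<lambda>b. b = last w"
  \<comment> \<open>The new letter comes last in the reversed word, so it is reached only when
    \<open>w\<close> is a single block, and then it differs from \<open>last w\<close>.\<close>
  have "takeWhile ?P (rev w @ [a]) = takeWhile ?P (rev w)"
  proof (cases "\<forall>x\<in>set w. ?P x")
    case True
    hence "set w = {last w}" using assms(1) by (auto simp: last_in_set)
    hence "a \<noteq> last w" using assms(2) by metis
    with True show ?thesis by (auto simp: takeWhile_append takeWhile_eq_all_conv[THEN iffD2])
  next
    case False
    thus ?thesis by (auto simp: takeWhile_append)
  qed
  with assms(1) show ?thesis by (simp add: beta_def)
qed

lemma out_rate_nonpower:
  assumes "w \<noteq> []" "\<And>b. set w \<noteq> {b}"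
  shows "out_rate n w = (out_rate n (tl w) :: 'k::field ratfun)"
proof -
  obtain b t where w: "w = b # t" using assms(1) by (cases w) auto
  \<comment> \<open>If \<open>t @ [c]\<close> were a power of \<open>b\<close>, then
    \<open>b # t\<close> would be one too.\<close>
  have "beta (b # t @ [c]) = (beta (t @ [c]) :: 'k ratfun)" for c
    using assms(2)[of b] unfolding w by (intro beta_Cons) auto
  thus ?thesis by (simp add: out_rate_def w)
qed

text \<open>Only the summand that appends \<open>b\<close> sees the longer block; any other appended
  letter forms a last block of length 1.\<close>

lemma out_rate_replicate:
  assumes "b \<in> {1..n}"
  shows "out_rate n (replicate (Suc k) b) =
    out_rate n (replicate k b) + beta (replicate (Suc (Suc k)) b) -
    (beta (replicate (Suc k) b) :: 'k::field ratfun)"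
proof -
  have snoc: "replicate m b @ [b] = replicate (Suc m) b" for m
    by (simp add: replicate_append_same)
  have other: "beta (replicate (Suc k) b @ [c]) = (beta (replicate k b @ [c]) :: 'k ratfun)" if "c \<noteq> b" for c
    using beta_Cons[of "replicate k b @ [c]" b] that by auto
  have split: "out_rate n w = (beta (w @ [b]) + (\<Sum>c\<in>{1..n} - {b}. beta (w @ [c])) :: 'k ratfun)"
    for w
    unfolding out_rate_def using assms by (intro sum.remove) auto
  have "(\<Sum>c\<in>{1..n} - {b}. beta (replicate (Suc k) b @ [c])) =
      (\<Sum>c\<in>{1..n} - {b}. beta (replicate k b @ [c]) :: 'k ratfun)"
    by (rule sum.cong) (use other in auto)
  thus ?thesis
    unfolding split[of "replicate (Suc k) b"] split[of "replicate k b"] snoc by simp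
qed

lemma sum_mubar_Cons:
  assumes n: "n \<ge> 1" and "set w \<subseteq> {1..n}"
  shows "(\<Sum>a\<in>{1..n}. mubar n (a # w)) = (mubar n w :: 'k::field ratfun)"
  using assms(2)
proof (induction w rule: rev_induct)
  case Nil
  have "mubar n [a] = (beta [a] / out_rate n [] :: 'k ratfun)" for a
    using mubar_snoc[of n "[]" a] by simp
  hence "(\<Sum>a\<in>{1..n}. mubar n [a]) = (\<Sum>a\<in>{1..n}. beta [a]) / (out_rate n [] :: 'k ratfun)"
    by (simp add: sum_divide_distrib)
  also have "(\<Sum>a\<in>{1..n}. beta [a]) = (out_rate n [] :: 'k ratfun)"
    by (simp add: out_rate_def)
  also have "out_rate n [] / out_rate n [] = (1 :: 'k ratfun)"
    using out_rate_nonzero[OF n] by simp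
  finally show ?case by simp
next
  case (snoc b w)
  let ?v = "w @ [b]"
  have IH: "(\<Sum>a\<in>{1..n}. mubar n (a # w)) = (mubar n w :: 'k ratfun)"
    using snoc by simp
  \<comment> \<open>Dropping \<open>a\<close> from \<open>a # ?v\<close> leaves \<open>?v\<close>,
    so the last denominator is the same for all \<open>a\<close> and can leave the sum.\<close>
  have "mubar n (a # ?v) = (mubar n (a # w) * beta (a # ?v) / out_rate n ?v :: 'k ratfun)" for a
    using mubar_snoc[of n "a # w" b] by simp
  hence step: "(\<Sum>a\<in>{1..n}. mubar n (a # ?v)) =
      (\<Sum>a\<in>{1..n}. mubar n (a # w) * beta (a # ?v)) / (out_rate n ?v :: 'k ratfun)"
    by (simp add: sum_divide_distrib)
  show ?case
  proof (cases "\<exists>c. set ?v = {c}")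
    case False
    have "beta (a # ?v) = (beta ?v :: 'k ratfun)" for a
      using False by (intro beta_Cons) blast+
    hence "(\<Sum>a\<in>{1..n}. mubar n (a # w) * beta (a # ?v)) = mubar n w * (beta ?v :: 'k ratfun)"
      by (simp only: sum_distrib_right[symmetric] IH)
    moreover have "out_rate n ?v = (out_rate n (tl ?v) :: 'k ratfun)"
      using False by (intro out_rate_nonpower) blast+
    ultimately show ?thesis by (simp only: step mubar_snoc)
  next
    case True
    define k where "k = length w"
    have "set w \<subseteq> {b}" using True by auto
    hence w: "w = replicate k b"
      unfolding k_def by (intro replicate_eqI) auto
    have v: "?v = replicate (Suc k) b"
      by (simp add: w replicate_append_same)
    have b: "b \<in> {1..n}" using snoc.prems by simp
    \<comment> \<open>For a power of \<open>b\<close>, prepending and appending \<open>b\<close>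
      agree, so the exceptional summand \<open>mubar n (b # w)\<close> is the target
      \<open>mubar n ?v\<close> itself.\<close>
    have bw: "b # w = ?v" by (simp add: w replicate_append_same)
    let ?x = "beta ?v :: 'k ratfun" and ?y = "beta (b # ?v) :: 'k ratfun"
    have other: "beta (a # ?v) = ?x" if "a \<noteq> b" for a
      using that by (intro beta_Cons) auto
    \<comment> \<open>The deviation at \<open>a = b\<close> is split off as a correction, so that
      the induction hypothesis sums the rest.\<close>
    have "(\<Sum>a\<in>{1..n}. mubar n (a # w) * beta (a # ?v)) =
        (\<Sum>a\<in>{1..n}. mubar n (a # w) * ?x + (if a = b then mubar n ?v * (?y - ?x) else 0))"
    proof (rule sum.cong[OF refl])
      fix a
      show "mubar n (a # w) * beta (a # ?v) =
          mubar n (a # w) * ?x + (if a = b then mubar n ?v * (?y - ?x) else 0)"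
      proof (cases "a = b")
        case True
        thus ?thesis unfolding True bw by (simp add: algebra_simps)
      next
        case False
        thus ?thesis by (simp add: other[OF False])
      qed
    qed
    also have "\<dots> = mubar n w * ?x + mubar n ?v * (?y - ?x)"
      using b IH by (simp add: sum.distrib sum_distrib_right[symmetric])
    \<comment> \<open>This is \<open>mubar_snoc\<close> for \<open>?v\<close> with the denominator
      cleared; for a power, \<open>tl ?v\<close> is again \<open>w\<close>.\<close>
    also have "mubar n w * ?x = mubar n ?v * out_rate n w"
    proof -
      have "tl ?v = w" by (metis bw list.sel(3))
      thus ?thesis
        using out_rate_nonzero[OF n, of w, where 'k = 'k] mubar_snoc[of n w b, where 'k = 'k] by simp
    qed
    \<comment> \<open>The correction \<open>?y - ?x\<close> in the numerator is exactly the change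
      from \<open>out_rate n w\<close> to \<open>out_rate n ?v\<close>.\<close>
    also have "mubar n ?v * out_rate n w + mubar n ?v * (?y - ?x) = mubar n ?v * out_rate n ?v"
    proof -
      have "out_rate n ?v = out_rate n w + ?y - ?x"
        using out_rate_replicate[OF b, of k, where 'k = 'k] by (simp only: v w[symmetric] replicate_Suc)
      hence "out_rate n w + (?y - ?x) = out_rate n ?v" by simp
      thus ?thesis by (simp only: distrib_left[symmetric])
    qed
    finally show ?thesis
      unfolding step using out_rate_nonzero[OF n, of ?v, where 'k = 'k] by simp
  qed
qed

theorem theorem3:
  fixes n L :: nat
  assumes "n \<ge> 1" and "L \<ge> 1"
  shows "stationary_vector n L (mubar n :: word \<Rightarrow> 'k::field ratfun)"
  unfolding stationary_vector_def
proof
  fix v assume v: "v \<in> words n L"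
  have fin: "finite (words n L)"
    unfolding words_def using finite_lists_length_eq[of "{1..n}" L] by simp
  define w where "w = butlast v"
  have ne: "v \<noteq> []" using v assms(2) by (auto simp: words_def)
  have vw: "v = w @ [last v]" using ne by (simp add: w_def)
  have w: "set w \<subseteq> {1..n}" "Suc (length w) = L"
    using v ne by (auto simp: words_def w_def dest: in_set_butlastD)
  \<comment> \<open>The sources of edges into \<open>v\<close> are the one-letter left extensions of
    its head, so the matrix product becomes the marginal sum over \<open>a\<close>.\<close>
  have pred: "{u \<in> words n L. (u, v) \<in> debruijn_edges n L} = (\<lambda>a. a # w) ` {1..n}"
  proof (intro subset_antisym subsetI)
    fix u assume "u \<in> {u \<in> words n L. (u, v) \<in> debruijn_edges n L}"
    thus "u \<in> (\<lambda>a. a # w) ` {1..n}"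
      using w(2) by (cases u) (auto simp: words_def debruijn_edges_def w_def)
  next
    fix u assume "u \<in> (\<lambda>a. a # w) ` {1..n}"
    thus "u \<in> {u \<in> words n L. (u, v) \<in> debruijn_edges n L}"
      using v w by (auto simp: words_def debruijn_edges_def w_def)
  qed
  have "mat_vec n L (debruijn_matrix n L) (mubar n :: word \<Rightarrow> 'k ratfun) v =
      (\<Sum>u\<in>words n L. if (u, v) \<in> debruijn_edges n L then beta v * mubar n u else 0)"
    unfolding mat_vec_def debruijn_matrix_def by (rule sum.cong) auto
  also have "\<dots> = (\<Sum>u\<in>(\<lambda>a. a # w) ` {1..n}. beta v * mubar n u)"
    using fin by (simp add: sum.inter_filter[symmetric] pred)
  also have "\<dots> = beta v * (\<Sum>a\<in>{1..n}. mubar n (a # w))"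
    by (subst sum.reindex) (auto simp: inj_on_def sum_distrib_left)
  also have "\<dots> = beta v * mubar n w"
    by (simp only: sum_mubar_Cons[OF assms(1) w(1)])
  \<comment> \<open>The recursion \<open>mubar_snoc\<close> at \<open>v\<close>, multiplied by its
    nonzero denominator.\<close>
  also have "\<dots> = out_rate n (tl v) * mubar n v"
    using mubar_snoc[of n w "last v", where 'k = 'k]
      out_rate_nonzero[OF assms(1), of "tl v", where 'k = 'k]
    by (simp add: vw[symmetric])
  also have "\<dots> = column_sum_matrix n L v v * mubar n v"
    by (simp add: column_sum_matrix_diag[OF assms(2) v] out_rate_def del_def)
  also have "\<dots> = (\<Sum>u\<in>words n L. if u = v then column_sum_matrix n L v v * mubar n v else 0)"
    using fin v by simp
  also have "\<dots> = mat_vec n L (column_sum_matrix n L) (mubar n) v"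
    unfolding mat_vec_def by (rule sum.cong) (auto simp: column_sum_matrix_def)
  finally show "mat_vec n L (debruijn_matrix n L) (mubar n :: word \<Rightarrow> 'k ratfun) v =
      mat_vec n L (column_sum_matrix n L) (mubar n) v" .
qed

end
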